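(* For all sufficiently large integers $n$ (with threshold independent of $f$) and all $f \in C([0,1])$, $$\frac{1}{8}\,\omega_2\left(f, n^{-3/2}\right) \le \|B_n f - f\|_\infty,$$ where $B_n$ is the Bernstein operator of order $n$.
   Context: The Bernstein operator $B_n : C([0,1]) \to C([0,1])$ is $B_n f(x) = \sum_{k=0}^n f\left(\frac{k}{n}\right)\binom{n}{k} x^k (1-x)^{n-k}$. The second modulus of smoothness is $\omega_2(f,t) := \sup_{0<|h|\le t}\ \sup\{|f(x) - 2f(x+h) + f(x+2h)| : x,\, x+2h \in [0,1]\}$. *)

theory Defs
  imports "HOL-Analysis.Analysis"
begin

text \<open>
  Elements of \<open>C([0,1])\<close> are represented by total functions that are continuous on \<open>{0..1}\<close>;
  none of the notions below looks at their values outside \<open>{0..1}\<close>.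
\<close>

definition bernstein_op :: "nat \<Rightarrow> (real \<Rightarrow> real) \<Rightarrow> real \<Rightarrow> real" where
  "bernstein_op n f x = (\<Sum>k\<le>n. f (real k / real n) * Bernstein n k x)"

definition sup_norm01 :: "(real \<Rightarrow> real) \<Rightarrow> real" where
  "sup_norm01 g = (SUP x\<in>{0..1}. \<bar>g x\<bar>)"

text \<open>
  The iterated supremum over \<open>h\<close> and \<open>x\<close> is taken over all admissible pairs at once, so that a
  step with \<open>\<bar>h\<bar> > 1/2\<close>, for which no \<open>x\<close> is admissible, contributes nothing (on the reals,
  \<open>Sup {}\<close> is an unspecified value). The value is meaningful for \<open>t > 0\<close>.
\<close>

definition omega2 :: "(real \<Rightarrow> real) \<Rightarrow> real \<Rightarrow> real" where
  "omega2 f t = Sup {\<bar>f x - 2 * f (x + h) + f (x + 2 * h)\<bar> | x h.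
     0 < \<bar>h\<bar> \<and> \<bar>h\<bar> \<le> t \<and> x \<in> {0..1} \<and> x + 2 * h \<in> {0..1}}"

lemma continuous_on_bernstein_op: "continuous_on {0..1} (bernstein_op n f)"
  unfolding bernstein_op_def Bernstein_def by (intro continuous_intros)

lemma bdd_above_second_differences:
  fixes f :: "real \<Rightarrow> real"
  assumes "continuous_on {0..1} f"
  shows "bdd_above {\<bar>f x - 2 * f (x + h) + f (x + 2 * h)\<bar> | x h.
     0 < \<bar>h\<bar> \<and> \<bar>h\<bar> \<le> t \<and> x \<in> {0..1} \<and> x + 2 * h \<in> {0..1}}"
proof -
  have "bounded (f ` {0..1})"
    using assms by (intro compact_imp_bounded compact_continuous_image) auto
  then obtain M where M: "\<And>x. x \<in> {0..1} \<Longrightarrow> \<bar>f x\<bar> \<le> M"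
    unfolding bounded_iff by (metis imageI real_norm_def)
  have "\<bar>f x - 2 * f (x + h) + f (x + 2 * h)\<bar> \<le> 4 * M"
    if "x \<in> {0..1}" "x + 2 * h \<in> {0..1}" for x h
  proof -
    have "x + h \<in> {0..1}" using that by auto
    with that M[of x] M[of "x + h"] M[of "x + 2 * h"] show ?thesis by linarith
  qed
  then show ?thesis by (intro bdd_aboveI[where M = "4 * M"]) auto
qed

lemma omega2_eq_iterated_SUP:
  fixes f :: "real \<Rightarrow> real"
  assumes "continuous_on {0..1} f" "0 < t" "t \<le> 1/2"
  shows "omega2 f t = (SUP h\<in>{h. 0 < \<bar>h\<bar> \<and> \<bar>h\<bar> \<le> t}.
     Sup {\<bar>f x - 2 * f (x + h) + f (x + 2 * h)\<bar> | x. x \<in> {0..1} \<and> x + 2 * h \<in> {0..1}})"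
proof -
  let ?H = "{h::real. 0 < \<bar>h\<bar> \<and> \<bar>h\<bar> \<le> t}"
  let ?D = "\<lambda>h. {\<bar>f x - 2 * f (x + h) + f (x + 2 * h)\<bar> | x. x \<in> {0..1} \<and> x + 2 * h \<in> {0..1}}"
  have eq: "{\<bar>f x - 2 * f (x + h) + f (x + 2 * h)\<bar> | x h.
     0 < \<bar>h\<bar> \<and> \<bar>h\<bar> \<le> t \<and> x \<in> {0..1} \<and> x + 2 * h \<in> {0..1}} = (\<Union>h\<in>?H. ?D h)"
    by blast
  have ne: "?D h \<noteq> {}" if "h \<in> ?H" for h
  proof -
    have "(if 0 \<le> h then 0 else 1::real) \<in> {0..1}" "(if 0 \<le> h then 0 else 1) + 2 * h \<in> {0..1}"
      using that assms(3) by auto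
    then show ?thesis by blast
  qed
  have bdd: "bdd_above (\<Union>h\<in>?H. ?D h)"
    using bdd_above_second_differences[OF assms(1), of t] unfolding eq .
  have "t \<in> ?H" using assms(2) by simp
  then have "?H \<noteq> {}" by blast
  then have "Sup ((\<lambda>y. y) ` (\<Union>h\<in>?H. ?D h)) = (SUP h\<in>?H. Sup ((\<lambda>y. y) ` ?D h))"
    by (rule cSUP_UNION) (use ne bdd in \<open>simp_all only: image_ident not_False_eq_True\<close>)
  then show ?thesis
    unfolding omega2_def eq by (simp only: image_ident)
qed

end

theory Submission
  imports Defs
begin

text \<open>
  Let \<open>\<epsilon>\<close> be the norm of \<open>B\<^sub>n f - f\<close> and \<open>d\<close> the largest second difference of the values
  \<open>f (k / n)\<close>. The second derivative of \<open>B\<^sub>n f\<close> is at most \<open>n (n - 1) d\<close>, so the second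
  differences of \<open>B\<^sub>n f\<close> with step \<open>1 / n\<close> are at most \<open>(1 - 1 / n) d\<close>. Comparing them with those
  of \<open>f\<close> gives \<open>d \<le> 4 \<epsilon> + (1 - 1 / n) d\<close>, that is \<open>d \<le> 4 n \<epsilon>\<close>. Hence the second derivative of
  \<open>B\<^sub>n f\<close> is at most \<open>4 n\<^sup>3 \<epsilon>\<close>, and the second differences of \<open>B\<^sub>n f\<close> with step at most
  \<open>n\<^bsup>-3/2\<^esup>\<close> are at most \<open>4 \<epsilon>\<close>; another \<open>4 \<epsilon>\<close> pays for the passage from \<open>B\<^sub>n f\<close> to \<open>f\<close>.
\<close>

text \<open>The coefficients are an arbitrary sequence, not values of a function on the grid of mesh
  \<open>1 / n\<close>, so that derivatives, whose coefficients are differences, stay in the same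
  class at lower degree.\<close>

definition bernstein_sum :: "nat \<Rightarrow> (nat \<Rightarrow> real) \<Rightarrow> real \<Rightarrow> real" where
  "bernstein_sum n v x = (\<Sum>k\<le>n. v k * Bernstein n k x)"

lemma bernstein_op_eq_sum: "bernstein_op n f = bernstein_sum n (\<lambda>k. f (real k / real n))"
  by (simp add: fun_eq_iff bernstein_op_def bernstein_sum_def)

lemma Bernstein_Suc_0: "Bernstein (Suc n) 0 x = (1 - x) * Bernstein n 0 x"
  by (simp add: Bernstein_def)

lemma Bernstein_Suc_Suc:
  "Bernstein (Suc n) (Suc k) x = x * Bernstein n k x + (1 - x) * Bernstein n (Suc k) x"
proof (cases "k < n")
  case True
  then have "n - k = Suc (n - Suc k)" by simp
  then show ?thesis by (simp add: Bernstein_def algebra_simps)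
next
  case False
  then show ?thesis by (simp add: Bernstein_def binomial_eq_0)
qed

text \<open>De Casteljau recursion, from Pascal's rule for the basis polynomials; it drives the
  induction for the derivative.\<close>

lemma bernstein_sum_Suc:
  "bernstein_sum (Suc n) v x =
    (1 - x) * bernstein_sum n v x + x * bernstein_sum n (\<lambda>k. v (Suc k)) x"
proof -
  have top: "Bernstein n (Suc n) x = 0"
    by (simp add: Bernstein_def)
  have shift: "bernstein_sum n v x =
      v 0 * Bernstein n 0 x + (\<Sum>k\<le>n. v (Suc k) * Bernstein n (Suc k) x)"
    using sum.atMost_Suc_shift[of "\<lambda>k. v k * Bernstein n k x" n]
    by (simp add: bernstein_sum_def top)
  have "bernstein_sum (Suc n) v x = v 0 * ((1 - x) * Bernstein n 0 x) +
      (\<Sum>k\<le>n. v (Suc k) * (x * Bernstein n k x + (1 - x) * Bernstein n (Suc k) x))"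
    unfolding bernstein_sum_def sum.atMost_Suc_shift Bernstein_Suc_0 Bernstein_Suc_Suc ..
  also have "\<dots> = (1 - x) * bernstein_sum n v x + x * bernstein_sum n (\<lambda>k. v (Suc k)) x"
    unfolding shift
    by (simp add: bernstein_sum_def algebra_simps sum.distrib sum_distrib_left sum_subtractf)
  finally show ?thesis .
qed

lemma bernstein_sum_diff:
  "bernstein_sum n (\<lambda>k. v k - w k) x = bernstein_sum n v x - bernstein_sum n w x"
  by (simp add: bernstein_sum_def algebra_simps sum_subtractf)

text \<open>Induction on the degree by the recursion and the product rule. \<open>v\<close> is
  generalised because the recursion also involves the shifted sequence.\<close>

lemma bernstein_sum_has_derivative:
  "(bernstein_sum (Suc n) v has_real_derivative
    real (Suc n) * bernstein_sum n (\<lambda>k. v (Suc k) - v k) x) (at x)"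
proof (induction n arbitrary: v)
  case 0
  have "bernstein_sum (Suc 0) v = (\<lambda>x. v 0 * (1 - x) + v 1 * x)"
    by (simp add: fun_eq_iff bernstein_sum_def Bernstein_def)
  moreover have "((\<lambda>x. v 0 * (1 - x) + v 1 * x) has_real_derivative v 1 - v 0) (at x)"
    by (auto intro!: derivative_eq_intros)
  ultimately show ?case
    by (simp add: bernstein_sum_def Bernstein_def)
next
  case (Suc n)
  let ?w = "\<lambda>k. v (Suc k)" and ?D = "\<lambda>v k. v (Suc k) - v k"
  have eq: "bernstein_sum (Suc (Suc n)) v =
      (\<lambda>x. (1 - x) * bernstein_sum (Suc n) v x + x * bernstein_sum (Suc n) ?w x)"
    by (rule ext) (rule bernstein_sum_Suc)
  \<comment> \<open>Read backwards, the recursion merges the two differentiated sums into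
    \<open>Suc n\<close> copies of this one; differentiating the factors \<open>1 - x\<close> and
    \<open>x\<close> supplies one more copy.\<close>
  have D: "bernstein_sum (Suc n) (?D v) x =
      (1 - x) * bernstein_sum n (?D v) x + x * bernstein_sum n (?D ?w) x"
    by (rule bernstein_sum_Suc)
  have "(bernstein_sum (Suc (Suc n)) v has_real_derivative
      (bernstein_sum (Suc n) ?w x - bernstein_sum (Suc n) v x) +
      real (Suc n) * ((1 - x) * bernstein_sum n (?D v) x + x * bernstein_sum n (?D ?w) x)) (at x)"
    unfolding eq
    by (rule derivative_eq_intros Suc.IH refl)+ (simp add: algebra_simps)
  then show ?case
    unfolding D[symmetric] by (simp add: bernstein_sum_diff algebra_simps)
qed

text \<open>On the unit interval the basis polynomials are nonnegative weights with sum 1.\<close>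

lemma abs_bernstein_sum_le:
  assumes "\<And>k. k \<le> n \<Longrightarrow> \<bar>v k\<bar> \<le> d" "x \<in> {0..1}"
  shows "\<bar>bernstein_sum n v x\<bar> \<le> d"
proof -
  have "\<bar>bernstein_sum n v x\<bar> \<le> (\<Sum>k\<le>n. \<bar>v k\<bar> * Bernstein n k x)"
    unfolding bernstein_sum_def using assms(2)
    by (intro order_trans[OF sum_abs] sum_mono) (simp add: abs_mult Bernstein_nonneg)
  also have "\<dots> \<le> (\<Sum>k\<le>n. d * Bernstein n k x)"
    using assms by (intro sum_mono mult_right_mono) (auto simp: Bernstein_nonneg)
  also have "\<dots> = d"
    by (simp flip: sum_distrib_left)
  finally show ?thesis .
qed

text \<open>Adding \<open>M / 2 * y\<^sup>2\<close> makes \<open>g\<close> convex, and the second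
  difference of that quadratic is exactly \<open>M * h\<^sup>2\<close>. The claim is then midpoint
  convexity, for either sign of \<open>h\<close>.\<close>

lemma second_difference_ge:
  fixes g :: "real \<Rightarrow> real"
  assumes g': "\<And>y. (g has_real_derivative g' y) (at y)"
    and g'': "\<And>y. (g' has_real_derivative g'' y) (at y)"
    and bound: "\<And>y. y \<in> {0..1} \<Longrightarrow> - M \<le> g'' y"
    and x: "x \<in> {0..1}" "x + 2 * h \<in> {0..1}"
  shows "- M * h\<^sup>2 \<le> g x - 2 * g (x + h) + g (x + 2 * h)"
proof -
  let ?H = "\<lambda>y. M / 2 * y\<^sup>2 + g y"
  have "convex_on {0..1} ?H"
  proof (rule f''_ge0_imp_convex)
    show "(?H has_real_derivative M * y + g' y) (at y)" for y
      by (auto intro!: derivative_eq_intros g')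
    show "((\<lambda>y. M * y + g' y) has_real_derivative M + g'' y) (at y)" for y
      by (auto intro!: derivative_eq_intros g'')
    show "0 \<le> M + g'' y" if "y \<in> {0..1}" for y
      using bound[OF that] by simp
  qed simp
  from convex_onD[OF this, of "1/2" x "x + 2 * h"] x
  have "?H ((1/2) * x + (1/2) * (x + 2 * h)) \<le> 1/2 * ?H x + 1/2 * ?H (x + 2 * h)"
    by simp
  moreover have "(1/2) * x + (1/2) * (x + 2 * h) = x + h"
    by (simp add: field_simps)
  ultimately have "?H (x + h) \<le> 1/2 * ?H x + 1/2 * ?H (x + 2 * h)"
    by simp
  then show ?thesis
    by (simp add: field_simps power2_eq_square)
qed

lemma abs_second_difference_le:
  fixes g :: "real \<Rightarrow> real"
  assumes g': "\<And>y. (g has_real_derivative g' y) (at y)"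
    and g'': "\<And>y. (g' has_real_derivative g'' y) (at y)"
    and bound: "\<And>y. y \<in> {0..1} \<Longrightarrow> \<bar>g'' y\<bar> \<le> M"
    and x: "x \<in> {0..1}" "x + 2 * h \<in> {0..1}"
  shows "\<bar>g x - 2 * g (x + h) + g (x + 2 * h)\<bar> \<le> M * h\<^sup>2"
proof -
  have "- M * h\<^sup>2 \<le> g x - 2 * g (x + h) + g (x + 2 * h)"
    using bound by (intro second_difference_ge[OF g' g'' _ x]) (simp add: abs_le_iff minus_le_iff)
  \<comment> \<open>The lower bound for \<open>- g\<close> is the upper bound for
    \<open>g\<close>.\<close>
  moreover have "- M * h\<^sup>2 \<le> - g x - 2 * - g (x + h) + - g (x + 2 * h)"
    using bound
    by (intro second_difference_ge[OF DERIV_minus[OF g'] DERIV_minus[OF g''] _ x])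
      (simp add: abs_le_iff)
  ultimately show ?thesis by linarith
qed

text \<open>Differentiating twice yields \<open>n * (n - 1)\<close> times a Bernstein sum of the
  second differences of \<open>v\<close>, hence bounded by their maximum.\<close>

lemma abs_second_difference_bernstein_sum_le:
  assumes "2 \<le> n"
    and d: "\<And>k. k + 2 \<le> n \<Longrightarrow> \<bar>v k - 2 * v (k + 1) + v (k + 2)\<bar> \<le> d"
    and x: "x \<in> {0..1}" "x + 2 * h \<in> {0..1}"
  shows "\<bar>bernstein_sum n v x - 2 * bernstein_sum n v (x + h) + bernstein_sum n v (x + 2 * h)\<bar>
    \<le> real n * (real n - 1) * d * h\<^sup>2"
proof -
  obtain m where n: "n = Suc (Suc m)"
    using \<open>2 \<le> n\<close> by (metis add_2_eq_Suc le_Suc_ex)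
  define v' where "v' k = v (Suc k) - v k" for k
  define v'' where "v'' k = v' (Suc k) - v' k" for k
  have d'': "\<bar>v'' k\<bar> \<le> d" if "k \<le> m" for k
    using d[of k] that by (simp add: n v''_def v'_def)
  show ?thesis unfolding n
  proof (rule abs_second_difference_le[OF _ _ _ x])
    show "(bernstein_sum (Suc (Suc m)) v has_real_derivative
        real (Suc (Suc m)) * bernstein_sum (Suc m) v' y) (at y)" for y
      unfolding v'_def by (rule bernstein_sum_has_derivative)
    show "((\<lambda>y. real (Suc (Suc m)) * bernstein_sum (Suc m) v' y) has_real_derivative
        real (Suc (Suc m)) * (real (Suc m) * bernstein_sum m v'' y)) (at y)" for y
      unfolding v''_def by (intro DERIV_cmult bernstein_sum_has_derivative)
    fix y :: real
    assume "y \<in> {0..1}"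
    then have "\<bar>bernstein_sum m v'' y\<bar> \<le> d"
      by (intro abs_bernstein_sum_le d'')
    then have "real (Suc (Suc m)) * real (Suc m) * \<bar>bernstein_sum m v'' y\<bar> \<le>
        real (Suc (Suc m)) * real (Suc m) * d"
      by (intro mult_left_mono) auto
    then show "\<bar>real (Suc (Suc m)) * (real (Suc m) * bernstein_sum m v'' y)\<bar> \<le>
        real (Suc (Suc m)) * (real (Suc (Suc m)) - 1) * d"
      by (simp add: abs_mult mult.assoc)
  qed
qed

lemma abs_le_sup_norm01:
  assumes "continuous_on {0..1} g" "x \<in> {0..1}"
  shows "\<bar>g x\<bar> \<le> sup_norm01 g"
proof -
  have "compact ((\<lambda>x. \<bar>g x\<bar>) ` {0..1})"
    using assms(1) by (intro compact_continuous_image continuous_intros) auto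
  then have "bdd_above ((\<lambda>x. \<bar>g x\<bar>) ` {0..1})"
    by (intro bounded_imp_bdd_above compact_imp_bounded)
  then show ?thesis
    unfolding sup_norm01_def using assms(2) by (rule cSUP_upper[rotated])
qed

text \<open>The factor 4 is the total weight 1 + 2 + 1 of a second difference.\<close>

lemma abs_second_difference_le_perturb:
  fixes f g :: "real \<Rightarrow> real"
  assumes "\<And>y. y \<in> {0..1} \<Longrightarrow> \<bar>g y - f y\<bar> \<le> e"
    and "x \<in> {0..1}" "x + 2 * h \<in> {0..1}"
  shows "\<bar>f x - 2 * f (x + h) + f (x + 2 * h)\<bar> \<le>
    4 * e + \<bar>g x - 2 * g (x + h) + g (x + 2 * h)\<bar>"
proof -
  have "x + h \<in> {0..1}" using assms(2,3) by auto
  with assms(1)[of x] assms(1)[of "x + h"] assms(1)[of "x + 2 * h"] assms(2,3)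
  show ?thesis by linarith
qed

lemma abs_second_difference_nodes_le:
  assumes n: "2 \<le> n" and e: "\<And>y. y \<in> {0..1} \<Longrightarrow> \<bar>bernstein_op n f y - f y\<bar> \<le> e"
    and k: "k + 2 \<le> n"
  defines "v \<equiv> \<lambda>k. f (real k / real n)"
  shows "\<bar>v k - 2 * v (k + 1) + v (k + 2)\<bar> \<le> 4 * real n * e"
proof -
  let ?\<Delta> = "\<lambda>k. \<bar>v k - 2 * v (k + 1) + v (k + 2)\<bar>"
  define d where "d = Max (?\<Delta> ` {..n - 2})"
  have d: "?\<Delta> j \<le> d" if "j + 2 \<le> n" for j
    unfolding d_def using that by (intro Max_ge) auto
  have "d \<in> ?\<Delta> ` {..n - 2}"
    unfolding d_def by (intro Max_in) auto
  \<comment> \<open>The maximum is attained, so the comparison at this single node bounds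
    \<open>d\<close> in terms of itself.\<close>
  then obtain j where j: "j + 2 \<le> n" "d = ?\<Delta> j"
    using n by (auto simp: le_diff_conv2)
  let ?x = "real j / real n" and ?h = "1 / real n"
  have nodes: "?x + ?h = real (j + 1) / real n" "?x + 2 * ?h = real (j + 2) / real n"
    by (simp_all add: add_divide_distrib)
  have x: "?x \<in> {0..1}" "?x + 2 * ?h \<in> {0..1}"
    unfolding nodes using j(1) by auto
  have "d = \<bar>f ?x - 2 * f (?x + ?h) + f (?x + 2 * ?h)\<bar>"
    unfolding nodes j(2) v_def ..
  also have "\<dots> \<le> 4 * e + \<bar>bernstein_op n f ?x - 2 * bernstein_op n f (?x + ?h) +
      bernstein_op n f (?x + 2 * ?h)\<bar>"
    by (rule abs_second_difference_le_perturb[OF e x])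
  also have "\<dots> \<le> 4 * e + real n * (real n - 1) * d * ?h\<^sup>2"
    unfolding bernstein_op_eq_sum v_def[symmetric]
    by (intro add_left_mono abs_second_difference_bernstein_sum_le[OF n d x])
  \<comment> \<open>The coefficient of \<open>d\<close> falls short of 1 by just
    \<open>1 / n\<close>; solving for \<open>d\<close> costs the factor \<open>n\<close>.\<close>
  also have "\<dots> = 4 * e + d - d / real n"
    using n by (simp add: field_simps power2_eq_square)
  finally have "d \<le> 4 * real n * e"
    using n by (simp add: field_simps)
  with d[OF k] show ?thesis by linarith
qed

theorem corollary3:
  shows "\<exists>N::nat. \<forall>n\<ge>N. \<forall>f :: real \<Rightarrow> real. continuous_on {0..1} f \<longrightarrow>
    1/8 * omega2 f (real n powr (-3/2)) \<le> sup_norm01 (\<lambda>x. bernstein_op n f x - f x)"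
\<comment> \<open>From \<open>n = 2\<close> on there are three consecutive nodes, and the step bound
  is at most 1/2.\<close>
proof (intro exI[of _ 2] allI impI)
  fix n :: nat and f :: "real \<Rightarrow> real"
  assume n: "2 \<le> n" and f: "continuous_on {0..1} f"
  define e where "e = sup_norm01 (\<lambda>x. bernstein_op n f x - f x)"
  define t where "t = real n powr (-3/2)"
  have e: "\<bar>bernstein_op n f y - f y\<bar> \<le> e" if "y \<in> {0..1}" for y
    unfolding e_def using that
    by (intro abs_le_sup_norm01 continuous_intros continuous_on_bernstein_op f)
  have "0 \<le> e"
    using e[of 0] by simp
  have "0 < t"
    using n by (simp add: t_def)
  have "t \<le> real n powr (-1)"
    unfolding t_def using n by (intro powr_mono) auto
  also have "\<dots> \<le> 1 / 2"
    using n by (simp add: powr_minus field_simps)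
  finally have "t \<le> 1 / 2" .
  \<comment> \<open>This is where the exponent -3/2 matters: \<open>t\<^sup>2\<close> cancels the
    factor \<open>n ^ 3\<close> in the bound for the second derivative of the Bernstein
    polynomial.\<close>
  have "t\<^sup>2 = real n powr (- real 3)"
    unfolding t_def power2_eq_square powr_add[symmetric] by simp
  then have t2: "t\<^sup>2 = 1 / real n ^ 3"
    using n by (simp only: powr_minus powr_realpow) (simp add: field_simps)
  have "omega2 f t \<le> 8 * e"
    unfolding omega2_def
  proof (rule cSup_least)
    \<comment> \<open>The pair \<open>x = 0\<close>, \<open>h = t\<close> is admissible because
      \<open>t \<le> 1 / 2\<close>; without an admissible pair the supremum would be
      unspecified.\<close>
    have "0 < \<bar>t\<bar> \<and> \<bar>t\<bar> \<le> t \<and> 0 \<in> {0..1::real} \<and> 0 + 2 * t \<in> {0..1}"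
      using \<open>0 < t\<close> \<open>t \<le> 1 / 2\<close> by simp
    then show "{\<bar>f x - 2 * f (x + h) + f (x + 2 * h)\<bar> | x h.
        0 < \<bar>h\<bar> \<and> \<bar>h\<bar> \<le> t \<and> x \<in> {0..1} \<and> x + 2 * h \<in> {0..1}} \<noteq> {}"
      by blast
  next
    fix z
    assume "z \<in> {\<bar>f x - 2 * f (x + h) + f (x + 2 * h)\<bar> | x h.
        0 < \<bar>h\<bar> \<and> \<bar>h\<bar> \<le> t \<and> x \<in> {0..1} \<and> x + 2 * h \<in> {0..1}}"
    then obtain x h where z: "z = \<bar>f x - 2 * f (x + h) + f (x + 2 * h)\<bar>"
      and h: "\<bar>h\<bar> \<le> t" and x: "x \<in> {0..1}" "x + 2 * h \<in> {0..1}"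
      by blast
    have "h\<^sup>2 \<le> t\<^sup>2"
      using h by (metis abs_ge_zero power2_abs power_mono)
    have "z \<le> 4 * e + \<bar>bernstein_op n f x - 2 * bernstein_op n f (x + h) +
        bernstein_op n f (x + 2 * h)\<bar>"
      unfolding z by (rule abs_second_difference_le_perturb[OF e x])
    also have "\<dots> \<le> 4 * e + real n * (real n - 1) * (4 * real n * e) * h\<^sup>2"
      unfolding bernstein_op_eq_sum
      by (intro add_left_mono
        abs_second_difference_bernstein_sum_le[OF n abs_second_difference_nodes_le[OF n e] x])
    also have "\<dots> \<le> 4 * e + real n * real n * (4 * real n * e) * t\<^sup>2"
      using n \<open>0 \<le> e\<close> \<open>h\<^sup>2 \<le> t\<^sup>2\<close> by (intro add_left_mono mult_mono) auto
    also have "\<dots> = 8 * e"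
      using n by (simp add: t2 field_simps power3_eq_cube)
    finally show "z \<le> 8 * e" .
  qed
  then show "1/8 * omega2 f (real n powr (-3/2)) \<le> sup_norm01 (\<lambda>x. bernstein_op n f x - f x)"
    by (simp add: t_def e_def)
qed

end
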